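(* Let $\alpha>0$, and let the weighted multigraph $G'$ differ from the weighted multigraph $G$ in a $(k,t)$ edge only. Then for all $i=1,\ldots,n$ the following equations hold: $$\frac{\tau'_{i(kt)}}{d'_{kt}}=\frac{\tau_{i(kt)}}{d_{kt}},\quad\text{or, equivalently,}\quad \frac{d'_{ik}-d'_{it}}{d'_{kt}}=\frac{d_{ik}-d_{it}}{d_{kt}};$$ $$\frac{\pi'_{i(kt)}}{d'_{kt}}=\frac{\pi_{i(kt)}}{d_{kt}},\quad\text{or, equivalently,}\quad \frac{q'_{ik}-q'_{it}}{d'_{kt}}=\frac{q_{ik}-q_{it}}{d_{kt}}.$$
   Context: A weighted multigraph $G$ has finite vertex set $V(G)=\{1,\ldots,n\}$; multiple edges are allowed, loops are not, and all edge weights are strictly positive. Its Laplacian matrix $L=L(G)=(\ell_{ij})$ is given by: for $j\ne i$, $\ell_{ij}$ is minus the sum of the weights of all edges with terminal vertices $i$ and $j$; and $\ell_{ii}=-\sum_{j\neq i}\ell_{ij}$. For a fixed parameter $\alpha>0$, the relative forest accessibility matrix is $Q=(q_{ij})=(I+\alpha L)^{-1}$, and the forest distance is $d_{ij}=\frac12(q_{ii}+q_{jj}-q_{ij}-q_{ji})$ (this is a metric on $V(G)$). For vertices $i,k,t$, put $\tau_{i(kt)}=d_{ik}-d_{it}$ and $\pi_{i(kt)}=q_{ik}-q_{it}$. For $k\neq t$, a weighted multigraph $G'$ (on the same vertex set) differs from $G$ in a $(k,t)$ edge only if, for some $\varepsilon\neq0$, $G'$ is obtained from $G$ by increasing the weight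 of some edge between $k$ and $t$ by $\varepsilon$, or by adding a new edge between $k$ and $t$ with weight $\varepsilon$ (when $\varepsilon>0$), or by removing an edge between $k$ and $t$ with weight $-\varepsilon$ (when $\varepsilon<0$). Unprimed quantities refer to $G$ and primed quantities refer to $G'$, with the same $\alpha$. *)

theory Defs
  imports "HOL-Analysis.Analysis" "HOL-Library.Multiset"
begin

text \<open>
  A weighted multigraph on the vertex type is the multiset of its edges; an edge is the set of its
  two terminal vertices together with its weight. Parallel edges, including those of equal weight,
  are counted by multiplicity.
\<close>

type_synonym 'v wmgraph = "('v set \<times> real) multiset"

definition weighted_multigraph :: "'v wmgraph \<Rightarrow> bool" where
  "weighted_multigraph G \<longleftrightarrow> (\<forall>(e, w) \<in> set_mset G. card e = 2 \<and> w > 0)"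

definition total_weight :: "'v wmgraph \<Rightarrow> 'v \<Rightarrow> 'v \<Rightarrow> real" where
  "total_weight G i j = (\<Sum>(e, w) \<in># filter_mset (\<lambda>(e, w). e = {i, j}) G. w)"

definition laplacian :: "'n::finite wmgraph \<Rightarrow> real ^ 'n ^ 'n" where
  "laplacian G =
    (\<chi> i j. if j = i then - (\<Sum>m \<in> UNIV - {i}. - total_weight G i m) else - total_weight G i j)"

definition forest_accessibility :: "real \<Rightarrow> 'n::finite wmgraph \<Rightarrow> real ^ 'n ^ 'n" where
  "forest_accessibility \<alpha> G = matrix_inv (mat 1 + \<alpha> *\<^sub>R laplacian G)"

definition forest_dist :: "real \<Rightarrow> 'n::finite wmgraph \<Rightarrow> 'n \<Rightarrow> 'n \<Rightarrow> real" where
  "forest_dist \<alpha> G i j =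
    (let Q = forest_accessibility \<alpha> G in (Q $ i $ i + Q $ j $ j - Q $ i $ j - Q $ j $ i) / 2)"

definition forest_tau :: "real \<Rightarrow> 'n::finite wmgraph \<Rightarrow> 'n \<Rightarrow> 'n \<Rightarrow> 'n \<Rightarrow> real" where
  "forest_tau \<alpha> G i k t = forest_dist \<alpha> G i k - forest_dist \<alpha> G i t"

definition forest_pi :: "real \<Rightarrow> 'n::finite wmgraph \<Rightarrow> 'n \<Rightarrow> 'n \<Rightarrow> 'n \<Rightarrow> real" where
  "forest_pi \<alpha> G i k t = forest_accessibility \<alpha> G $ i $ k - forest_accessibility \<alpha> G $ i $ t"

text \<open>
  In the first case \<open>\<epsilon>\<close> may be negative; that the changed edge keeps a positive weight is
  expressed by requiring \<open>G'\<close> to be a weighted multigraph where this relation is used.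
\<close>

definition differs_in_edge_only :: "'v \<Rightarrow> 'v \<Rightarrow> 'v wmgraph \<Rightarrow> 'v wmgraph \<Rightarrow> bool" where
  "differs_in_edge_only k t G G' \<longleftrightarrow>
    k \<noteq> t \<and>
    (\<exists>\<epsilon>. \<epsilon> \<noteq> 0 \<and>
      ((\<exists>H w. G = add_mset ({k, t}, w) H \<and> G' = add_mset ({k, t}, w + \<epsilon>) H) \<or>
       (\<epsilon> > 0 \<and> G' = add_mset ({k, t}, \<epsilon>) G) \<or>
       (\<epsilon> < 0 \<and> G = add_mset ({k, t}, - \<epsilon>) G')))"

end

(*
  Let M = I + \<alpha> L and z = e_k - e_t. Changing the weight between k and t by \<epsilon> replaces M by
  M + \<alpha> \<epsilon> z z^T, hence Q' z = s Q z with the scalar s = 1 - \<alpha> \<epsilon> z^T Q' z, and s is nonzero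
  because Q' is invertible. The entries of Q z are the numbers \<pi>_{i(kt)}, while d_{kt} and, by
  symmetry of Q, all \<tau>_{i(kt)} are fixed linear combinations of them; so all of these quantities
  are multiplied by the same s.
*)

theory Submission
  imports Defs
begin

lemma total_weight_nonneg:
  assumes "weighted_multigraph G"
  shows "total_weight G i j \<ge> 0"
  using assms
  by (induction G) (auto simp: total_weight_def weighted_multigraph_def intro: add_nonneg_nonneg)

lemma total_weight_commute: "total_weight G i j = total_weight G j i"
  by (simp add: total_weight_def insert_commute)

lemma total_weight_add_mset:
  "total_weight (add_mset (e, w) G) i j = total_weight G i j + (if e = {i, j} then w else 0)"
  by (simp add: total_weight_def)

text \<open>Reweighting, adding and removing an edge all become one signed shift \<epsilon> of the
  total weight between \<open>k\<close> and \<open>t\<close>, so no later argument distinguishes the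
  three cases.\<close>

lemma total_weight_differs:
  assumes "differs_in_edge_only k t G G'"
  obtains \<epsilon> where "k \<noteq> t"
    and "\<And>i j. total_weight G' i j = total_weight G i j + (if {k, t} = {i, j} then \<epsilon> else 0)"
proof -
  from assms have kt: "k \<noteq> t"
    by (simp add: differs_in_edge_only_def)
  from assms have "\<exists>\<epsilon>. \<forall>i j.
      total_weight G' i j = total_weight G i j + (if {k, t} = {i, j} then \<epsilon> else 0)"
    unfolding differs_in_edge_only_def
    by (elim conjE exE disjE; simp only: total_weight_add_mset) fastforce+
  with kt that show thesis
    by blast
qed

text \<open>Zero row sums turn the product into weighted differences. In this form its sign at a
  maximal entry and the effect of a changed weight can be read off.\<close>

lemma laplacian_mult_vec:
  "(laplacian G *v x) $ i = (\<Sum>j\<in>UNIV. total_weight G i j * (x $ i - x $ j))"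
proof -
  have "(laplacian G *v x) $ i = (\<Sum>j\<in>UNIV. laplacian G $ i $ j * x $ j)"
    by (simp add: matrix_vector_mult_def)
  also have "\<dots> = laplacian G $ i $ i * x $ i + (\<Sum>j\<in>UNIV - {i}. laplacian G $ i $ j * x $ j)"
    by (simp add: sum.remove)
  also have "\<dots> = (\<Sum>j\<in>UNIV - {i}. total_weight G i j * (x $ i - x $ j))"
    by (simp add: laplacian_def sum_negf sum_distrib_right right_diff_distrib sum_subtractf)
  \<comment> \<open>The restored term \<open>j = i\<close> vanishes because its factor
    \<open>x $ i - x $ j\<close> is 0.\<close>
  also have "\<dots> = (\<Sum>j\<in>UNIV. total_weight G i j * (x $ i - x $ j))"
    by (simp add: sum.remove[of UNIV i])
  finally show ?thesis .
qed

lemma transpose_laplacian: "transpose (laplacian G) = laplacian G"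
  by (auto simp: vec_eq_iff transpose_def laplacian_def total_weight_commute)

definition forest_matrix :: "real \<Rightarrow> 'n::finite wmgraph \<Rightarrow> real ^ 'n ^ 'n" where
  "forest_matrix \<alpha> G = mat 1 + \<alpha> *\<^sub>R laplacian G"

lemma forest_matrix_mult_vec: "forest_matrix \<alpha> G *v x = x + \<alpha> *\<^sub>R (laplacian G *v x)"
  by (simp add: forest_matrix_def matrix_vector_mult_add_rdistrib scaleR_matrix_vector_assoc)

text \<open>Maximum principle: \<open>L x\<close> is nonnegative at a maximal entry of \<open>x\<close>.\<close>

lemma forest_matrix_ker_nonpos:
  fixes x :: "real ^ 'n::finite"
  assumes "\<alpha> > 0" and "weighted_multigraph G" and "forest_matrix \<alpha> G *v x = 0"
  shows "x $ j \<le> 0"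
proof -
  have "Max (range (($) x)) \<in> range (($) x)"
    by (intro Max_in) auto
  then obtain i where i: "x $ i = Max (range (($) x))"
    by (metis imageE)
  have max: "x $ m \<le> x $ i" for m
    unfolding i by (rule Max_ge) auto
  have "x $ i + \<alpha> * (laplacian G *v x) $ i = 0"
    using assms(3) by (simp add: forest_matrix_mult_vec vec_eq_iff)
  moreover have "(laplacian G *v x) $ i \<ge> 0"
    unfolding laplacian_mult_vec
    by (intro sum_nonneg mult_nonneg_nonneg total_weight_nonneg assms) (simp add: max)
  then have "\<alpha> * (laplacian G *v x) $ i \<ge> 0"
    using assms(1) by simp
  ultimately show ?thesis
    using max[of j] by linarith
qed

text \<open>The kernel is closed under negation, so the bound on its entries applies to
  \<open>x\<close> and to \<open>- x\<close> and forces \<open>x = 0\<close>.\<close>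

lemma invertible_forest_matrix:
  assumes "\<alpha> > 0" and "weighted_multigraph G"
  shows "invertible (forest_matrix \<alpha> G)"
proof -
  have "x = 0" if x: "forest_matrix \<alpha> G *v x = 0" for x
  proof -
    have "forest_matrix \<alpha> G *v (- x) = 0"
      using x by (simp add: vec.neg)
    then show ?thesis
      using forest_matrix_ker_nonpos[OF assms x] forest_matrix_ker_nonpos[OF assms, of "- x"]
      by (simp add: vec_eq_iff order_antisym)
  qed
  then show ?thesis
    by (simp add: invertible_left_inverse matrix_left_invertible_ker)
qed

text \<open>\<open>matrix_inv\<close> is a choice operator; invertibility is what makes the chosen
  matrix a two-sided inverse.\<close>

lemma forest_accessibility_inverse:
  assumes "\<alpha> > 0" and "weighted_multigraph G"
  shows "forest_accessibility \<alpha> G ** forest_matrix \<alpha> G = mat 1"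
    and "forest_matrix \<alpha> G ** forest_accessibility \<alpha> G = mat 1"
proof -
  have "\<exists>B. forest_matrix \<alpha> G ** B = mat 1 \<and> B ** forest_matrix \<alpha> G = mat 1"
    using invertible_forest_matrix[OF assms] by (simp add: invertible_def)
  then have "forest_matrix \<alpha> G ** matrix_inv (forest_matrix \<alpha> G) = mat 1 \<and>
      matrix_inv (forest_matrix \<alpha> G) ** forest_matrix \<alpha> G = mat 1"
    unfolding matrix_inv_def by (rule someI_ex)
  then show "forest_accessibility \<alpha> G ** forest_matrix \<alpha> G = mat 1"
    and "forest_matrix \<alpha> G ** forest_accessibility \<alpha> G = mat 1"
    by (simp_all add: forest_accessibility_def forest_matrix_def)
qed

lemma forest_accessibility_commute:
  assumes "\<alpha> > 0" and "weighted_multigraph G"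
  shows "forest_accessibility \<alpha> G $ i $ j = forest_accessibility \<alpha> G $ j $ i"
proof -
  let ?Q = "forest_accessibility \<alpha> G" and ?M = "forest_matrix \<alpha> G"
  have "transpose ?M = ?M"
    using transpose_laplacian[of G]
    by (simp add: forest_matrix_def transpose_def vec_eq_iff mat_def)
  then have "transpose ?Q ** ?M = mat 1"
    by (metis forest_accessibility_inverse(2)[OF assms] matrix_transpose_mul transpose_mat)
  \<comment> \<open>With Q and M for \<open>?Q\<close> and \<open>?M\<close>: Q^T = Q^T (M Q) = (Q^T
    M) Q = Q.\<close>
  then have "transpose ?Q = ?Q"
    by (metis forest_accessibility_inverse(2)[OF assms] matrix_mul_assoc matrix_mul_lid
        matrix_mul_rid)
  then show ?thesis
    by (metis transpose_def vec_lambda_beta)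
qed

lemma forest_pi_eq_mult_vec:
  "forest_pi \<alpha> G i k t = (forest_accessibility \<alpha> G *v (axis k 1 - axis t 1)) $ i"
  by (simp add: forest_pi_def matrix_vector_mult_diff_distrib matrix_vector_mul_component
      inner_axis)

lemma forest_dist_eq_forest_pi:
  "forest_dist \<alpha> G k t = (forest_pi \<alpha> G k k t - forest_pi \<alpha> G t k t) / 2"
  by (simp add: forest_dist_def forest_pi_def Let_def)

text \<open>By symmetry of Q, d_{ik} - d_{it} = (q_{kk} - q_{tt})/2 - (q_{ik} - q_{it}), and q_{kk}
  - q_{tt} = (q_{kk} - q_{kt}) + (q_{tk} - q_{tt}).\<close>

lemma forest_tau_eq_forest_pi:
  assumes "\<alpha> > 0" and "weighted_multigraph G"
  shows "forest_tau \<alpha> G i k t =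
    (forest_pi \<alpha> G k k t + forest_pi \<alpha> G t k t) / 2 - forest_pi \<alpha> G i k t"
  using forest_accessibility_commute[OF assms, of k i] forest_accessibility_commute[OF assms, of t i]
    forest_accessibility_commute[OF assms, of k t]
  by (simp add: forest_tau_def forest_dist_def forest_pi_def Let_def field_simps)

text \<open>The rank-one update \<alpha> \<epsilon> z z^T applied to \<open>x\<close>: the factor
  \<open>x $ k - x $ t\<close> is z^T x for z = \<open>axis k 1 - axis t 1\<close>.\<close>

lemma forest_matrix_differs:
  fixes G G' :: "'n::finite wmgraph"
  assumes "k \<noteq> t"
    and "\<And>i j. total_weight G' i j = total_weight G i j + (if {k, t} = {i, j} then \<epsilon> else 0)"
  shows "forest_matrix \<alpha> G' *v x =
    forest_matrix \<alpha> G *v x + (\<alpha> * \<epsilon> * (x $ k - x $ t)) *\<^sub>R (axis k 1 - axis t 1)"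
proof -
  have "(laplacian G' *v x) $ i =
      (laplacian G *v x) $ i + \<epsilon> * (x $ k - x $ t) * (axis k 1 - axis t 1) $ i" for i
  proof -
    \<comment> \<open>Only rows \<open>k\<close> and \<open>t\<close> change, each by a single term,
      at \<open>j = t\<close> and \<open>j = k\<close> respectively; the two changes are
      opposite.\<close>
    have "(\<Sum>j\<in>UNIV. (if {k, t} = {i, j} then \<epsilon> else 0) * (x $ i - x $ j)) =
        (\<Sum>j\<in>UNIV. if i = k \<and> j = t \<or> i = t \<and> j = k then \<epsilon> * (x $ i - x $ j) else 0)"
      by (intro sum.cong) (auto simp: doubleton_eq_iff)
    also have "\<dots> = \<epsilon> * (x $ k - x $ t) * (axis k 1 - axis t 1) $ i"
      using assms(1) by (auto simp: axis_def algebra_simps)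
    finally show ?thesis
      by (simp add: laplacian_mult_vec assms(2) distrib_right sum.distrib)
  qed
  then have "laplacian G' *v x =
      laplacian G *v x + (\<epsilon> * (x $ k - x $ t)) *\<^sub>R (axis k 1 - axis t 1)"
    by (simp add: vec_eq_iff)
  then show ?thesis
    by (simp add: forest_matrix_mult_vec scaleR_add_right mult.assoc)
qed

lemma forest_pi_differs:
  fixes G G' :: "'n::finite wmgraph"
  assumes "\<alpha> > 0" and "weighted_multigraph G" and "weighted_multigraph G'"
    and "differs_in_edge_only k t G G'"
  obtains s where "s \<noteq> 0" and "\<And>i. forest_pi \<alpha> G' i k t = s * forest_pi \<alpha> G i k t"
proof -
  obtain \<epsilon> where kt: "k \<noteq> t"
    and w: "\<And>i j. total_weight G' i j = total_weight G i j + (if {k, t} = {i, j} then \<epsilon> else 0)"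
    using total_weight_differs[OF assms(4)] by metis
  define z :: "real ^ 'n" where "z = axis k 1 - axis t 1"
  let ?Q = "forest_accessibility \<alpha> G" and ?Q' = "forest_accessibility \<alpha> G'"
  define y' where "y' = ?Q' *v z"
  define c where "c = \<alpha> * \<epsilon> * (y' $ k - y' $ t)"
  have z: "forest_matrix \<alpha> G' *v y' = z"
    by (simp add: y'_def matrix_vector_mul_assoc forest_accessibility_inverse(2)[OF assms(1,3)])
  then have "z = forest_matrix \<alpha> G *v y' + c *\<^sub>R z"
    by (simp add: forest_matrix_differs[OF kt w] c_def z_def)
  \<comment> \<open>Applying \<open>?Q\<close> cancels the old matrix in front of \<open>y'\<close>,
    so that \<open>y'\<close> becomes a multiple of \<open>?Q *v z\<close>.\<close>
  then have "?Q *v z = ?Q *v (forest_matrix \<alpha> G *v y') + c *\<^sub>R (?Q *v z)"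
    by (metis matrix_vector_right_distrib matrix_vector_mult_scaleR)
  then have y': "y' = (1 - c) *\<^sub>R (?Q *v z)"
    by (simp add: matrix_vector_mul_assoc forest_accessibility_inverse(1)[OF assms(1,2)]
        algebra_simps)
  \<comment> \<open>If the factor \<open>1 - c\<close> were 0, then \<open>y'\<close> would be 0,
    and so would its image \<open>z\<close> under the new matrix.\<close>
  have "z $ k \<noteq> 0"
    using kt by (simp add: z_def axis_def)
  then have "y' \<noteq> 0"
    using z by auto
  with y' have "1 - c \<noteq> 0"
    by auto
  moreover have "forest_pi \<alpha> G' i k t = (1 - c) * forest_pi \<alpha> G i k t" for i
    using arg_cong[OF y', of "\<lambda>v. v $ i"] by (simp add: forest_pi_eq_mult_vec y'_def z_def)
  ultimately show thesis
    by (rule that)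
qed

theorem proposition9:
  fixes \<alpha> :: real and G G' :: "'n::finite wmgraph" and k t :: 'n
  assumes "\<alpha> > 0"
    and "weighted_multigraph G"
    and "weighted_multigraph G'"
    and "differs_in_edge_only k t G G'"
  shows "\<forall>i.
      forest_tau \<alpha> G' i k t / forest_dist \<alpha> G' k t = forest_tau \<alpha> G i k t / forest_dist \<alpha> G k t \<and>
      (forest_dist \<alpha> G' i k - forest_dist \<alpha> G' i t) / forest_dist \<alpha> G' k t =
        (forest_dist \<alpha> G i k - forest_dist \<alpha> G i t) / forest_dist \<alpha> G k t \<and>
      forest_pi \<alpha> G' i k t / forest_dist \<alpha> G' k t = forest_pi \<alpha> G i k t / forest_dist \<alpha> G k t \<and>
      (forest_accessibility \<alpha> G' $ i $ k - forest_accessibility \<alpha> G' $ i $ t) / forest_dist \<alpha> G' k t =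
        (forest_accessibility \<alpha> G $ i $ k - forest_accessibility \<alpha> G $ i $ t) / forest_dist \<alpha> G k t"
proof -
  obtain s where s: "s \<noteq> 0"
    and pi: "\<And>i. forest_pi \<alpha> G' i k t = s * forest_pi \<alpha> G i k t"
    using forest_pi_differs[OF assms] by metis
  have dist: "forest_dist \<alpha> G' k t = s * forest_dist \<alpha> G k t"
    by (simp add: forest_dist_eq_forest_pi pi right_diff_distrib)
  have tau: "forest_tau \<alpha> G' i k t = s * forest_tau \<alpha> G i k t" for i
    by (simp add: forest_tau_eq_forest_pi assms pi algebra_simps add_divide_distrib)
  \<comment> \<open>The common factor \<open>s\<close> cancels because it is nonzero; a zero
    denominator would make both quotients 0 by the convention for division by 0.\<close>
  have "forest_tau \<alpha> G' i k t / forest_dist \<alpha> G' k t = forest_tau \<alpha> G i k t / forest_dist \<alpha> G k t"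
    and "forest_pi \<alpha> G' i k t / forest_dist \<alpha> G' k t = forest_pi \<alpha> G i k t / forest_dist \<alpha> G k t" for i
    using s by (simp_all add: dist tau pi)
  then show ?thesis
    unfolding forest_tau_def forest_pi_def by blast
qed

end
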